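(* With $S(n_1,n_2)$ and $S(n_2,n_3)$ the sets defined in the context, one has $$\#S(n_1,n_2)\lesssim N_3\qquad\text{and}\qquad\#S(n_2,n_3)\lesssim N_1,$$ where the first bound holds for all fixed $n_1,n_2$ and the second for all fixed $n_2,n_3$, with implicit constants independent of $\mu,N_1,N_2,N_3$ and of the fixed vectors.
   Context: Fix a real number $\gamma\in(1,2)$. For $n,m\in\mathbb{Z}^2$ let $\langle n,m\rangle=n_1m_1+\gamma n_2m_2$ (coordinates) and $|n|=\sqrt{\langle n,n\rangle}$. Fix a constant $K\ge1$, numbers $N_1,N_2,N_3\ge1$ and $\mu\in\mathbb{R}$ with $|\mu|\le K\max(N_1,N_2,N_3)$. Let $$S=\{(n_1,n_2,n_3)\in(\mathbb{Z}^2)^3:\ |n_i|\sim N_i\ (i=1,2,3),\ n_2\ne n_1,\ n_2\neq n_3,\ \langle n_2-n_1,n_2-n_3\rangle=\mu+O(1)\},$$ where $|n_i|\sim N_i$ means $N_i/K\le|n_i|\le KN_i$ and $a=\mu+O(1)$ means $|a-\mu|\le K$. For fixed $n_1,n_2$ let $S(n_1,n_2)=\{n_3:(n_1,n_2,n_3)\in S\}$; for fixed $n_2,n_3$ let $S(n_2,n_3)=\{n_1:(n_1,n_2,n_3)\in S\}$. Implicit constants in $\lesssim$ may depend on $K$. *)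

theory Defs
  imports Complex_Main "HOL-Library.Product_Plus"
begin

definition ip :: "real \<Rightarrow> int \<times> int \<Rightarrow> int \<times> int \<Rightarrow> real" where
  "ip \<gamma> n m = of_int (fst n) * of_int (fst m) + \<gamma> * of_int (snd n) * of_int (snd m)"

definition nrm :: "real \<Rightarrow> int \<times> int \<Rightarrow> real" where
  "nrm \<gamma> n = sqrt (ip \<gamma> n n)"

definition comparable :: "real \<Rightarrow> real \<Rightarrow> real \<Rightarrow> bool" where
  "comparable K a N \<longleftrightarrow> N / K \<le> a \<and> a \<le> K * N"

definition S :: "real \<Rightarrow> real \<Rightarrow> real \<Rightarrow> real \<Rightarrow> real \<Rightarrow> real \<Rightarrow>
    ((int \<times> int) \<times> (int \<times> int) \<times> (int \<times> int)) set" where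
  "S \<gamma> K N1 N2 N3 \<mu> = {(n1, n2, n3).
     comparable K (nrm \<gamma> n1) N1 \<and> comparable K (nrm \<gamma> n2) N2 \<and> comparable K (nrm \<gamma> n3) N3 \<and>
     n2 \<noteq> n1 \<and> n2 \<noteq> n3 \<and>
     \<bar>ip \<gamma> (n2 - n1) (n2 - n3) - \<mu>\<bar> \<le> K}"

definition S12 :: "real \<Rightarrow> real \<Rightarrow> real \<Rightarrow> real \<Rightarrow> real \<Rightarrow> real \<Rightarrow>
    int \<times> int \<Rightarrow> int \<times> int \<Rightarrow> (int \<times> int) set" where
  "S12 \<gamma> K N1 N2 N3 \<mu> n1 n2 = {n3. (n1, n2, n3) \<in> S \<gamma> K N1 N2 N3 \<mu>}"

definition S23 :: "real \<Rightarrow> real \<Rightarrow> real \<Rightarrow> real \<Rightarrow> real \<Rightarrow> real \<Rightarrow>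
    int \<times> int \<Rightarrow> int \<times> int \<Rightarrow> (int \<times> int) set" where
  "S23 \<gamma> K N1 N2 N3 \<mu> n2 n3 = {n1. (n1, n2, n3) \<in> S \<gamma> K N1 N2 N3 \<mu>}"

end

theory Submission
  imports Defs
begin

text \<open>
  Once two of the three vectors are fixed, the constraint on the remaining one is affine.
  If \<open>d = (a, b)\<close> is the nonzero difference of the two fixed vectors, then
  \<open>\<langle>d, n\<^sub>2 - v\<rangle> = \<mu> + O(1)\<close> confines the unknown \<open>v = (x, y)\<close> to a strip
  \<open>a x + \<gamma> b y = c + O(1)\<close>. As \<open>a\<close> and \<open>b\<close> are integers, not both zero, and \<open>\<gamma> > 1\<close>, one of the
  coefficients \<open>a\<close>, \<open>\<gamma> b\<close> has modulus at least \<open>1\<close>. For each value of the other coordinate,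
  the coordinate carrying this coefficient then lies in an interval of bounded length, so it takes
  boundedly many integer values. The size condition \<open>|v| \<lesssim> N\<close> leaves \<open>O(N)\<close> values for the other
  coordinate, and \<open>O(N)\<close> is therefore a bound for the whole count (lemma \<open>card_box_strip\<close>).
  The interval length depends only on \<open>K\<close>, which makes the constant uniform in \<open>\<mu>\<close> and \<open>d\<close>.
  The two claims are the same claim, because the form is symmetric.
\<close>

lemma card_int_near_le:
  fixes p c K :: real
  assumes "\<bar>p\<bar> \<ge> 1" "K \<ge> 0"
  shows "finite {x::int. \<bar>p * x - c\<bar> \<le> K}"
    and "real (card {x::int. \<bar>p * x - c\<bar> \<le> K}) \<le> 2 * K + 1"
proof -
  let ?I = "{\<lceil>c / p - K\<rceil>..\<lfloor>c / p + K\<rfloor>}"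
  have sub: "{x::int. \<bar>p * x - c\<bar> \<le> K} \<subseteq> ?I"
  proof
    fix x :: int
    assume "x \<in> {x::int. \<bar>p * x - c\<bar> \<le> K}"
    moreover have "\<bar>p * x - c\<bar> = \<bar>p\<bar> * \<bar>x - c / p\<bar>"
      using assms(1) by (auto simp flip: abs_mult simp: field_simps)
    moreover have "1 * \<bar>x - c / p\<bar> \<le> \<bar>p\<bar> * \<bar>x - c / p\<bar>"
      using assms(1) by (intro mult_right_mono) auto
    ultimately have "\<bar>x - c / p\<bar> \<le> K" by simp
    then have "c / p - K \<le> x" "x \<le> c / p + K" by linarith+
    then show "x \<in> ?I" by (simp add: ceiling_le_iff le_floor_iff)
  qed
  show "finite {x::int. \<bar>p * x - c\<bar> \<le> K}"
    using sub by (rule finite_subset) simp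
  have "card {x::int. \<bar>p * x - c\<bar> \<le> K} \<le> card ?I"
    using sub by (intro card_mono) auto
  moreover have "real (card ?I) \<le> 2 * K + 1"
    using assms(2) by (auto simp: of_nat_nat) linarith+
  ultimately show "real (card {x::int. \<bar>p * x - c\<bar> \<le> K}) \<le> 2 * K + 1"
    by linarith
qed

text \<open>
  Sliced along its second coordinate, the strip has slices of at most \<open>2 * K + 1\<close> points, because
  the coefficient of the first coordinate has modulus at least \<open>1\<close>.
\<close>

lemma card_strip:
  fixes p q c K R :: real
  assumes "\<bar>p\<bar> \<ge> 1" "K \<ge> 0" "R \<ge> 0"
  defines "T \<equiv> {(x::int, y::int). \<bar>y\<bar> \<le> R \<and> \<bar>p * x + q * y - c\<bar> \<le> K}"
  shows "finite T \<and> real (card T) \<le> (2 * R + 1) * (2 * K + 1)"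
proof -
  define Y where "Y = {y::int. \<bar>y\<bar> \<le> R}"
  define X where "X y = {x::int. \<bar>p * x - (c - q * y)\<bar> \<le> K}" for y :: int
  have Y: "finite Y" "real (card Y) \<le> 2 * R + 1"
    using card_int_near_le[of 1 R 0] assms(3) unfolding Y_def by simp_all
  have X: "finite (X y)" "real (card (X y)) \<le> 2 * K + 1" for y
    using card_int_near_le[OF assms(1,2), of "c - q * y"] unfolding X_def by simp_all
  have T: "T = prod.swap ` Sigma Y X"
    unfolding T_def Y_def X_def by (force simp: algebra_simps image_iff)
  have "card T = card (Sigma Y X)"
    unfolding T by (intro card_image) (auto simp: inj_on_def)
  also have "\<dots> = (\<Sum>y\<in>Y. card (X y))"
    using X Y by simp
  finally have "real (card T) = (\<Sum>y\<in>Y. real (card (X y)))" by simp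
  also have "\<dots> \<le> real (card Y) * (2 * K + 1)"
    using X(2) by (intro sum_bounded_above) auto
  also have "\<dots> \<le> (2 * R + 1) * (2 * K + 1)"
    using Y assms(2) by (intro mult_right_mono) auto
  finally show ?thesis using X Y T by auto
qed

lemma card_box_strip:
  fixes p q c K R :: real
  assumes "\<bar>p\<bar> \<ge> 1 \<or> \<bar>q\<bar> \<ge> 1" "K \<ge> 0" "R \<ge> 0"
  defines "B \<equiv> {(x::int, y::int). \<bar>x\<bar> \<le> R \<and> \<bar>y\<bar> \<le> R \<and> \<bar>p * x + q * y - c\<bar> \<le> K}"
  shows "finite B \<and> real (card B) \<le> (2 * R + 1) * (2 * K + 1)"
proof -
  have "\<exists>T. B \<subseteq> T \<and> finite T \<and> real (card T) \<le> (2 * R + 1) * (2 * K + 1)"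
    using assms(1)
  proof
    assume "\<bar>p\<bar> \<ge> 1"
    then show ?thesis
      using card_strip[of p K R q c] assms(2,3)
      by (intro exI[of _ "{(x::int, y::int). \<bar>y\<bar> \<le> R \<and> \<bar>p * x + q * y - c\<bar> \<le> K}"]) (auto simp: B_def)
  next
    assume q: "\<bar>q\<bar> \<ge> 1"
    define T where "T = {(x::int, y::int). \<bar>y\<bar> \<le> R \<and> \<bar>q * x + p * y - c\<bar> \<le> K}"
    have "finite T \<and> real (card T) \<le> (2 * R + 1) * (2 * K + 1)"
      using card_strip[of q K R p c] q assms(2,3) unfolding T_def by simp
    moreover have "card (prod.swap ` T) = card T"
      by (intro card_image) (auto simp: inj_on_def)
    moreover have "B \<subseteq> prod.swap ` T"
      unfolding B_def T_def by (force simp: algebra_simps image_iff)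
    ultimately show ?thesis by (metis finite_imageI)
  qed
  then obtain T where T: "B \<subseteq> T" "finite T" "real (card T) \<le> (2 * R + 1) * (2 * K + 1)"
    by blast
  then have "card B \<le> card T" by (intro card_mono)
  then show ?thesis using T finite_subset by fastforce
qed

lemma abs_coord_le_nrm:
  assumes "\<gamma> > 1"
  shows "\<bar>real_of_int (fst v)\<bar> \<le> nrm \<gamma> v" "\<bar>real_of_int (snd v)\<bar> \<le> nrm \<gamma> v"
proof -
  have "1 * (real_of_int (snd v))\<^sup>2 \<le> \<gamma> * (real_of_int (snd v))\<^sup>2"
    using assms by (intro mult_right_mono) auto
  moreover have "ip \<gamma> v v = (real_of_int (fst v))\<^sup>2 + \<gamma> * (real_of_int (snd v))\<^sup>2"
    by (simp add: ip_def power2_eq_square)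
  moreover have "(real_of_int (fst v))\<^sup>2 \<ge> 0" "(real_of_int (snd v))\<^sup>2 \<ge> 0" by simp_all
  ultimately have "(real_of_int (fst v))\<^sup>2 \<le> ip \<gamma> v v" "(real_of_int (snd v))\<^sup>2 \<le> ip \<gamma> v v"
    by linarith+
  then show "\<bar>real_of_int (fst v)\<bar> \<le> nrm \<gamma> v" "\<bar>real_of_int (snd v)\<bar> \<le> nrm \<gamma> v"
    unfolding nrm_def by (auto intro: real_le_rsqrt)
qed

lemma ip_commute: "ip \<gamma> n m = ip \<gamma> m n"
  by (simp add: ip_def)

text \<open>
  The common core of both bounds: \<open>d\<close> is the difference of the two fixed vectors and \<open>w\<close> is the
  middle one.
\<close>

lemma card_lattice_strip:
  fixes \<gamma> K N \<mu> :: real and d w :: "int \<times> int"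
  assumes "\<gamma> > 1" "K \<ge> 1" "N \<ge> 1" "d \<noteq> 0"
    and A: "A \<subseteq> {v. nrm \<gamma> v \<le> K * N \<and> \<bar>ip \<gamma> d (w - v) - \<mu>\<bar> \<le> K}"
  shows "finite A \<and> real (card A) \<le> (2 * K + 1)\<^sup>2 * N"
proof -
  define p q where "p = real_of_int (fst d)" and "q = \<gamma> * real_of_int (snd d)"
  define c where "c = ip \<gamma> d w - \<mu>"
  define B where "B = {(x::int, y::int).
    \<bar>x\<bar> \<le> K * N \<and> \<bar>y\<bar> \<le> K * N \<and> \<bar>p * x + q * y - c\<bar> \<le> K}"
  have "\<bar>p\<bar> \<ge> 1 \<or> \<bar>q\<bar> \<ge> 1"
  proof (cases "fst d = 0")
    case True
    with assms(4) have "snd d \<noteq> 0" by (simp add: prod_eq_iff)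
    then have "1 \<le> \<bar>real_of_int (snd d)\<bar>" by linarith
    then have "1 * 1 \<le> \<gamma> * \<bar>real_of_int (snd d)\<bar>"
      using assms(1) by (intro mult_mono) auto
    then show ?thesis using assms(1) by (simp add: q_def abs_mult)
  next
    case False
    then show ?thesis unfolding p_def by linarith
  qed
  then have B: "finite B \<and> real (card B) \<le> (2 * (K * N) + 1) * (2 * K + 1)"
    using card_box_strip[of p q K "K * N" c] assms(2,3) unfolding B_def by simp
  have "A \<subseteq> B"
  proof
    fix v assume "v \<in> A"
    with A have v: "nrm \<gamma> v \<le> K * N" "\<bar>ip \<gamma> d (w - v) - \<mu>\<bar> \<le> K" by auto
    have "ip \<gamma> d (w - v) - \<mu> = - (p * fst v + q * snd v - c)"
      by (simp add: ip_def p_def q_def c_def algebra_simps)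
    with v(2) have "\<bar>p * fst v + q * snd v - c\<bar> \<le> K" by (simp only: abs_minus_cancel)
    moreover have "\<bar>real_of_int (fst v)\<bar> \<le> K * N" "\<bar>real_of_int (snd v)\<bar> \<le> K * N"
      using abs_coord_le_nrm[OF assms(1), of v] v(1) by linarith+
    ultimately show "v \<in> B" unfolding B_def by (auto simp: case_prod_unfold)
  qed
  with B have "finite A" "card A \<le> card B" by (auto intro: finite_subset card_mono)
  moreover have "(2 * (K * N) + 1) * (2 * K + 1) \<le> ((2 * K + 1) * N) * (2 * K + 1)"
    using assms(2,3) by (intro mult_right_mono) (auto simp: algebra_simps)
  ultimately show ?thesis using B by (simp add: power2_eq_square mult.assoc mult.commute mult.left_commute)
qed

theorem lemma4p3:
  fixes K :: real
  assumes "K \<ge> 1"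
  shows "\<exists>C>0. \<forall>\<gamma> N1 N2 N3 \<mu> :: real.
    1 < \<gamma> \<and> \<gamma> < 2 \<and> N1 \<ge> 1 \<and> N2 \<ge> 1 \<and> N3 \<ge> 1 \<and> \<bar>\<mu>\<bar> \<le> K * Max {N1, N2, N3} \<longrightarrow>
    (\<forall>n1 n2. finite (S12 \<gamma> K N1 N2 N3 \<mu> n1 n2) \<and> real (card (S12 \<gamma> K N1 N2 N3 \<mu> n1 n2)) \<le> C * N3) \<and>
    (\<forall>n2 n3. finite (S23 \<gamma> K N1 N2 N3 \<mu> n2 n3) \<and> real (card (S23 \<gamma> K N1 N2 N3 \<mu> n2 n3)) \<le> C * N1)"
proof (intro exI[of _ "(2 * K + 1)\<^sup>2"] conjI[of "(2 * K + 1)\<^sup>2 > 0"] allI impI, goal_cases)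
  case 1
  then show ?case using assms by simp
next
  case (2 \<gamma> N1 N2 N3 \<mu>)
  then have *: "\<gamma> > 1" "N1 \<ge> 1" "N3 \<ge> 1" by auto
  show ?case
  proof (intro conjI[of "All _" "All _"] allI)
    fix n1 n2
    show "finite (S12 \<gamma> K N1 N2 N3 \<mu> n1 n2) \<and>
      real (card (S12 \<gamma> K N1 N2 N3 \<mu> n1 n2)) \<le> (2 * K + 1)\<^sup>2 * N3"
    proof (cases "n2 = n1")
      case True
      then show ?thesis using * by (simp add: S12_def S_def)
    next
      case False
      then show ?thesis
        by (intro card_lattice_strip[OF *(1) assms *(3), of "n2 - n1" _ n2 \<mu>])
           (auto simp: S12_def S_def comparable_def)
    qed
  next
    fix n2 n3
    show "finite (S23 \<gamma> K N1 N2 N3 \<mu> n2 n3) \<and>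
      real (card (S23 \<gamma> K N1 N2 N3 \<mu> n2 n3)) \<le> (2 * K + 1)\<^sup>2 * N1"
    proof (cases "n2 = n3")
      case True
      then show ?thesis using * by (simp add: S23_def S_def)
    next
      case False
      then show ?thesis
        by (intro card_lattice_strip[OF *(1) assms *(2), of "n2 - n3" _ n2 \<mu>])
           (auto simp: S23_def S_def comparable_def ip_commute[of \<gamma> "n2 - n3"])
    qed
  qed
qed

end
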